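(* For all integers $n\ge1$, $$\chi_{\mathcal{L}(\mathcal{H}_{2n-1})}(t)=\sum_{k=1}^{2n}s_D(2n,k)\,t^{k-1},$$ where $(-1)^k s_D(2n,k)$ is equal to the number of D-permutations on $[2n]$ with exactly $k$ cycles (fixed points counted as cycles).
   Context: For $n\ge 1$, the homogenized Linial arrangement $\mathcal{H}_{2n-1}$ is the set of hyperplanes $\{x_i - x_j = y_i\}$, $1 \le i < j \le n+1$, in $\mathbb{R}^{2n+1}$ with coordinates $(x_1,\dots,x_{n+1},y_1,\dots,y_n)$. Its intersection lattice $\mathcal{L}(\mathcal{H}_{2n-1})$ is the set of all intersections of subsets of these hyperplanes (the empty intersection being the whole space), ordered by reverse inclusion. For a finite ranked poset $P$ of length $\ell$ with minimum $\hat0$, Möbius function $\mu_P$ and rank function $\mathrm{rk}$, the characteristic polynomial is $\chi_P(t)=\sum_{x\in P}\mu_P(\hat0,x)t^{\ell-\mathrm{rk}(x)}$. (The lattice $\mathcal{L}(\mathcal{H}_{2n-1})$ has length $2n-1$.) A permutation $\sigma$ of $[2n]=\{1,\dots,2n\}$ is a D-permutation if $i\le\sigma(i)$ whenever $i$ is odd and $i\ge\sigma(i)$ whenever $i$ is even. *)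

theory Defs
  imports "HOL-Computational_Algebra.Polynomial" "HOL-Combinatorics.Orbits"
    "HOL-Combinatorics.Permutations"
begin

section \<open>Finite posets\<close>

text \<open>
  A poset is given by its order relation \<open>r\<close>, with \<open>(x, y) \<in> r\<close> meaning $x \le y$;
  its set of elements is \<open>Field r\<close> (which is the whole carrier, by reflexivity).
\<close>

definition poset_bot :: "'a rel \<Rightarrow> 'a" where
  "poset_bot r = (THE z. z \<in> Field r \<and> (\<forall>x\<in>Field r. (z, x) \<in> r))"

text \<open>
  The length of a chain \<open>C\<close> is \<open>card C - 1\<close>. The rank of \<open>x\<close> is the length of a longest
  chain of elements below \<open>x\<close>; in a ranked poset this is the length of every
  maximal chain of elements below \<open>x\<close>.
\<close>

definition poset_length :: "'a rel \<Rightarrow> nat" where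
  "poset_length r = Max {card C - 1 | C. C \<in> Chains r \<and> C \<noteq> {}}"

definition poset_rank :: "'a rel \<Rightarrow> 'a \<Rightarrow> nat" where
  "poset_rank r x = Max {card C - 1 | C. C \<in> Chains r \<and> C \<noteq> {} \<and> (\<forall>c\<in>C. (c, x) \<in> r)}"

text \<open>
  The guard on \<open>r\<close> is needed for termination of the recursion
  $\mu(x,x) = 1$, $\mu(x,y) = -\sum_{x \le z < y} \mu(x,z)$.
\<close>

function moebius :: "'a rel \<Rightarrow> 'a \<Rightarrow> 'a \<Rightarrow> int" where
  "moebius r x y =
     (if finite r \<and> Partial_order r \<and> (x, y) \<in> r
      then if x = y then 1
           else - (\<Sum>z | (x, z) \<in> r \<and> (z, y) \<in> r \<and> z \<noteq> y. moebius r x z)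
      else 0)"
  by auto
termination
proof (relation "measure (\<lambda>(r, x, y). card {w. (x, w) \<in> r \<and> (w, y) \<in> r})")
  fix r :: "'a rel" and x y z
  assume g: "finite r \<and> Partial_order r \<and> (x, y) \<in> r"
    and z: "z \<in> {z. (x, z) \<in> r \<and> (z, y) \<in> r \<and> z \<noteq> y}"
  from g have tr: "trans r" and an: "antisym r" and rf: "refl_on (Field r) r"
    by (auto simp: partial_order_on_def preorder_on_def)
  have fin: "finite {w. (x, w) \<in> r \<and> (w, y) \<in> r}"
  proof (rule finite_subset)
    show "{w. (x, w) \<in> r \<and> (w, y) \<in> r} \<subseteq> Field r"
      by (blast intro: FieldI1)
    show "finite (Field r)"
      using g by (simp add: finite_Field)
  qed
  have yy: "(y, y) \<in> r"
    using g rf by (metis FieldI2 refl_onD)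
  have sub: "{w. (x, w) \<in> r \<and> (w, z) \<in> r} \<subseteq> {w. (x, w) \<in> r \<and> (w, y) \<in> r}"
    using z transD[OF tr] by blast
  have "y \<notin> {w. (x, w) \<in> r \<and> (w, z) \<in> r}"
    using z antisymD[OF an] by blast
  moreover have "y \<in> {w. (x, w) \<in> r \<and> (w, y) \<in> r}"
    using g yy by auto
  ultimately have "{w. (x, w) \<in> r \<and> (w, z) \<in> r} \<subset> {w. (x, w) \<in> r \<and> (w, y) \<in> r}"
    using sub by blast
  from psubset_card_mono[OF fin this]
  show "((r, x, z), r, x, y) \<in> measure (\<lambda>(r, x, y). card {w. (x, w) \<in> r \<and> (w, y) \<in> r})"
    by simp
qed simp

declare moebius.simps [simp del]

definition char_poly_poset :: "'a rel \<Rightarrow> int poly" where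
  "char_poly_poset r =
     (\<Sum>x\<in>Field r. monom (moebius r (poset_bot r) x) (poset_length r - poset_rank r x))"


section \<open>The homogenized Linial arrangement\<close>

text \<open>
  A point $(x_1,\dots,x_{n+1},y_1,\dots,y_n)$ of $\mathbb{R}^{2n+1}$ is a pair \<open>(x, y)\<close> of
  extensional functions with domains \<open>{1..n+1}\<close> and \<open>{1..n}\<close>. The arrangement called
  $\mathcal{H}_{2n-1}$ in the literature is \<open>homog_linial n\<close>.
\<close>

type_synonym point = "(nat \<Rightarrow> real) \<times> (nat \<Rightarrow> real)"

definition ambient :: "nat \<Rightarrow> point set" where
  "ambient n = ({1..n+1} \<rightarrow>\<^sub>E UNIV) \<times> ({1..n} \<rightarrow>\<^sub>E UNIV)"

definition linial_hyperplane :: "nat \<Rightarrow> nat \<Rightarrow> nat \<Rightarrow> point set" where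
  "linial_hyperplane n i j = {(x, y) \<in> ambient n. x i - x j = y i}"

definition homog_linial :: "nat \<Rightarrow> point set set" where
  "homog_linial n = {linial_hyperplane n i j | i j. 1 \<le> i \<and> i < j \<and> j \<le> n + 1}"

text \<open>The intersection with \<open>V\<close> makes the empty intersection the whole space \<open>V\<close>.\<close>

definition intersections :: "'a set \<Rightarrow> 'a set set \<Rightarrow> 'a set set" where
  "intersections V \<A> = {V \<inter> \<Inter>\<B> | \<B>. \<B> \<subseteq> \<A>}"

definition intersection_lattice :: "'a set \<Rightarrow> 'a set set \<Rightarrow> 'a set rel" where
  "intersection_lattice V \<A> =
     {(A, B). A \<in> intersections V \<A> \<and> B \<in> intersections V \<A> \<and> B \<subseteq> A}"

definition linial_lattice :: "nat \<Rightarrow> point set rel" where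
  "linial_lattice n = intersection_lattice (ambient n) (homog_linial n)"


section \<open>D-permutations\<close>

definition D_permutation :: "nat \<Rightarrow> (nat \<Rightarrow> nat) \<Rightarrow> bool" where
  "D_permutation m \<sigma> \<longleftrightarrow> \<sigma> permutes {1..m} \<and>
     (\<forall>i\<in>{1..m}. (odd i \<longrightarrow> i \<le> \<sigma> i) \<and> (even i \<longrightarrow> \<sigma> i \<le> i))"

text \<open>The cycles correspond to the orbits; a fixed point contributes a singleton orbit.\<close>

definition num_cycles :: "nat \<Rightarrow> (nat \<Rightarrow> nat) \<Rightarrow> nat" where
  "num_cycles m \<sigma> = card (orbit \<sigma> ` {1..m})"

definition s_D :: "nat \<Rightarrow> nat \<Rightarrow> int" where
  "s_D m k = (-1) ^ k * int (card {\<sigma>. D_permutation m \<sigma> \<and> num_cycles m \<sigma> = k})"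


section \<open>Well-definedness\<close>

text \<open>
  The hypotheses guarding \<open>moebius\<close> hold for the lattice under consideration, and its
  minimum is the whole space.
\<close>

lemma finite_homog_linial: "finite (homog_linial n)"
proof -
  have "homog_linial n \<subseteq> (\<lambda>(i, j). linial_hyperplane n i j) ` ({..n+1} \<times> {..n+1})"
  proof
    fix H assume "H \<in> homog_linial n"
    then obtain i j where "H = linial_hyperplane n i j" "i < j" "j \<le> n + 1"
      by (auto simp: homog_linial_def)
    then show "H \<in> (\<lambda>(i, j). linial_hyperplane n i j) ` ({..n+1} \<times> {..n+1})"
      by (intro image_eqI[of _ _ "(i, j)"]) simp_all
  qed
  then show ?thesis
    by (rule finite_subset) simp
qed

lemma Field_intersection_lattice:
  "Field (intersection_lattice V \<A>) = intersections V \<A>"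
  by (auto simp: Field_def intersection_lattice_def)

lemma Partial_order_intersection_lattice: "Partial_order (intersection_lattice V \<A>)"
  unfolding partial_order_on_def preorder_on_def Field_intersection_lattice
  by (auto simp: intersection_lattice_def refl_on_def trans_def antisym_def)

lemma finite_linial_lattice: "finite (linial_lattice n)"
proof -
  have "intersections (ambient n) (homog_linial n)
      = (\<lambda>\<B>. ambient n \<inter> \<Inter>\<B>) ` Pow (homog_linial n)"
    by (auto simp: intersections_def)
  then have "finite (intersections (ambient n) (homog_linial n))"
    by (simp add: finite_homog_linial)
  moreover have "linial_lattice n
      \<subseteq> intersections (ambient n) (homog_linial n) \<times> intersections (ambient n) (homog_linial n)"
    by (auto simp: linial_lattice_def intersection_lattice_def)
  ultimately show ?thesis
    by (meson finite_SigmaI finite_subset)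
qed

lemma poset_bot_intersection_lattice: "poset_bot (intersection_lattice V \<A>) = V"
proof -
  have V: "V \<in> intersections V \<A>"
    by (auto simp: intersections_def intro!: exI[of _ "{}"])
  have sub: "A \<subseteq> V" if "A \<in> intersections V \<A>" for A
    using that by (auto simp: intersections_def)
  show ?thesis
    unfolding poset_bot_def Field_intersection_lattice
    using V sub by (intro the_equality) (auto simp: intersection_lattice_def)
qed

end

theory Submission
  imports Defs
begin

text \<open>
  Up to the free coordinate \<open>x 1\<close>, the arrangement is the graphical arrangement of the bipartite graph
  on \<open>{1..2*n}\<close> joining each odd vertex to all larger even ones. By Moebius inversion, \<open>t\<close> times its
  characteristic polynomial counts the proper colourings with \<open>t\<close> colours. On the other side,
  \<open>(-1) ^ k\<close> is the sign of a permutation of \<open>{1..2*n}\<close> with \<open>k\<close> cycles, and \<open>t ^ k\<close> counts the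
  colourings it leaves invariant. Exchanging the two sums, each colouring \<open>c\<close> contributes the signed
  number of D-permutations preserving \<open>c\<close>. For proper \<open>c\<close> only the identity preserves \<open>c\<close>;
  otherwise composing with the transposition of a closest monochromatic edge is a sign-reversing
  involution.
\<close>

section \<open>Counting colourings\<close>

text \<open>Such a colouring factors uniquely through \<open>q\<close>, so it amounts to an
  arbitrary function on the image of \<open>S\<close>; \<open>inv_into S q\<close> picks the
  representatives that recover this function.\<close>

lemma card_PiE_factoring:
  assumes "finite S"
  shows "card {c \<in> S \<rightarrow>\<^sub>E T. \<forall>u\<in>S. \<forall>v\<in>S. q u = q v \<longrightarrow> c u = c v} = card T ^ card (q ` S)"
    (is "card ?F = _")
proof -
  have "bij_betw (\<lambda>g. restrict (g \<circ> q) S) (q ` S \<rightarrow>\<^sub>E T) ?F"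
  proof (rule bij_betwI[where g = "\<lambda>c. restrict (c \<circ> inv_into S q) (q ` S)"])
    show "(\<lambda>g. restrict (g \<circ> q) S) \<in> (q ` S \<rightarrow>\<^sub>E T) \<rightarrow> ?F"
    proof (intro funcsetI CollectI conjI ballI impI)
      fix g u v assume "u \<in> S" "v \<in> S" "q u = q v"
      then show "restrict (g \<circ> q) S u = restrict (g \<circ> q) S v"
        by simp
    qed auto
    show "(\<lambda>c. restrict (c \<circ> inv_into S q) (q ` S)) \<in> ?F \<rightarrow> (q ` S \<rightarrow>\<^sub>E T)"
    proof (intro funcsetI PiE_I)
      fix c w assume c: "c \<in> ?F" and w: "w \<in> q ` S"
      then have "c (inv_into S q w) \<in> T"
        using inv_into_into[OF w] by blast
      with w show "restrict (c \<circ> inv_into S q) (q ` S) w \<in> T"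
        by simp
    qed simp
    show "restrict (restrict (g \<circ> q) S \<circ> inv_into S q) (q ` S) = g"
      if "g \<in> q ` S \<rightarrow>\<^sub>E T" for g
    proof
      fix w show "restrict (restrict (g \<circ> q) S \<circ> inv_into S q) (q ` S) w = g w"
        using that by (cases "w \<in> q ` S") (auto simp: inv_into_into f_inv_into_f)
    qed
    show "restrict (restrict (c \<circ> inv_into S q) (q ` S) \<circ> q) S = c" if c: "c \<in> ?F" for c
    proof
      fix u show "restrict (restrict (c \<circ> inv_into S q) (q ` S) \<circ> q) S u = c u"
      proof (cases "u \<in> S")
        case True
        then have "inv_into S q (q u) \<in> S" "q (inv_into S q (q u)) = q u"
          by (auto simp: inv_into_into f_inv_into_f)
        with True c have "c (inv_into S q (q u)) = c u" by blast
        with True show ?thesis by simp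
      next
        case False
        with c have "c u = undefined" by blast
        with False show ?thesis by simp
      qed
    qed
  qed
  then have "card ?F = card (q ` S \<rightarrow>\<^sub>E T)"
    by (rule bij_betw_same_card[symmetric])
  then show ?thesis
    using assms by (simp add: card_funcsetE)
qed

lemma invariant_iff_constant_on_orbits:
  assumes "\<sigma> permutes S" "finite S"
  shows "(\<forall>u\<in>S. c (\<sigma> u) = c u) \<longleftrightarrow> (\<forall>u\<in>S. \<forall>v\<in>S. orbit \<sigma> u = orbit \<sigma> v \<longrightarrow> c u = c v)"
proof -
  have perm: "permutation \<sigma>"
    using assms permutation_permutes by blast
  show ?thesis
  proof (intro iffI ballI impI)
    fix u v assume inv: "\<forall>u\<in>S. c (\<sigma> u) = c u" and uv: "u \<in> S" "v \<in> S" "orbit \<sigma> u = orbit \<sigma> v"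
    have "v \<in> orbit \<sigma> u"
      using permutation_self_in_orbit[OF perm] uv(3) by simp
    \<comment> \<open>Membership in \<open>S\<close> is carried through the orbit induction because
      invariance is assumed only on \<open>S\<close>.\<close>
    then have "v \<in> S \<and> c v = c u"
      by induction (use inv uv(1) permutes_in_image[OF assms(1)] in auto)
    then show "c u = c v" by simp
  next
    fix u assume *: "\<forall>u\<in>S. \<forall>v\<in>S. orbit \<sigma> u = orbit \<sigma> v \<longrightarrow> c u = c v" and "u \<in> S"
    then show "c (\<sigma> u) = c u"
      using permutation_orbit_step[OF perm] permutes_in_image[OF assms(1)] by blast
  qed
qed

lemma card_invariant:
  assumes "\<sigma> permutes S" "finite S"
  shows "card {c \<in> S \<rightarrow>\<^sub>E T. \<forall>u\<in>S. c (\<sigma> u) = c u} = card T ^ card (orbit \<sigma> ` S)"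
  unfolding invariant_iff_constant_on_orbits[OF assms] by (rule card_PiE_factoring) fact

section \<open>The sign of a permutation and its number of cycles\<close>

text \<open>The transposition splices \<open>a\<close> into the cycle of \<open>b\<close>, directly
  before \<open>b\<close>. Orbits are compared through invariant 2-colourings, which number 2 to the
  number of orbits: the colour of \<open>a\<close> must be that of \<open>b\<close>, so restriction
  to \<open>S\<close> is a bijection.\<close>

lemma card_orbits_transpose_insert:
  assumes q: "q permutes S" and "finite S" "a \<notin> S" "b \<in> S"
  shows "card (orbit (transpose a b \<circ> q) ` insert a S) = card (orbit q ` S)"
proof -
  define p where "p = transpose a b \<circ> q"
  have p: "p permutes insert a S"
    unfolding p_def using q \<open>b \<in> S\<close>
    by (intro permutes_compose permutes_swap_id) (auto intro: permutes_subset)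
  have qa: "q a = a"
    using q \<open>a \<notin> S\<close> by (simp add: permutes_def)
  have pS: "p u = (if q u = b then a else q u)" if "u \<in> S" for u
    using permutes_in_image[OF q, of u] that \<open>a \<notin> S\<close> by (auto simp: p_def transpose_def)
  have pa: "p a = b"
    by (simp add: p_def qa)
  let ?P = "{c \<in> insert a S \<rightarrow>\<^sub>E {..<2::nat}. \<forall>u\<in>insert a S. c (p u) = c u}"
  let ?Q = "{c \<in> S \<rightarrow>\<^sub>E {..<2::nat}. \<forall>u\<in>S. c (q u) = c u}"
  have "bij_betw (\<lambda>c. restrict c S) ?P ?Q"
  proof (rule bij_betwI[where g = "\<lambda>c. c(a := c b)"])
    show "(\<lambda>c. restrict c S) \<in> ?P \<rightarrow> ?Q"
    proof
      fix c assume c: "c \<in> ?P"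
      have "c (q u) = c u" if "u \<in> S" for u
        using c that pS[OF that] pa by (auto split: if_splits)
      then show "restrict c S \<in> ?Q"
        using c permutes_in_image[OF q] by auto
    qed
    show "(\<lambda>c. c(a := c b)) \<in> ?Q \<rightarrow> ?P"
    proof
      fix c assume c: "c \<in> ?Q"
      have "(c(a := c b)) (p u) = (c(a := c b)) u" if "u \<in> insert a S" for u
      proof (cases "u = a")
        case True
        then show ?thesis using pa \<open>a \<notin> S\<close> by simp
      next
        case False
        then have u: "u \<in> S" using that by simp
        have "q u \<noteq> a" using permutes_in_image[OF q, of u] u \<open>a \<notin> S\<close> by auto
        moreover have "c (q u) = c u" using c u by simp
        ultimately show ?thesis using False pS[OF u] by auto
      qed
      moreover have "c(a := c b) \<in> insert a S \<rightarrow>\<^sub>E {..<2}"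
        using c \<open>b \<in> S\<close> by (auto simp: PiE_iff extensional_def)
      ultimately show "c(a := c b) \<in> ?P" by blast
    qed
    show "(restrict c S)(a := restrict c S b) = c" if c: "c \<in> ?P" for c
    proof
      fix u
      have "c b = c a" using c pa by (metis (mono_tags, lifting) insertI1 mem_Collect_eq)
      then show "((restrict c S)(a := restrict c S b)) u = c u"
        using c \<open>b \<in> S\<close> by (auto simp: restrict_def PiE_iff extensional_def)
    qed
    show "restrict (c(a := c b)) S = c" if "c \<in> ?Q" for c
    proof
      fix u show "restrict (c(a := c b)) S u = c u"
        using that \<open>a \<notin> S\<close> by (auto simp: restrict_def PiE_iff extensional_def)
    qed
  qed
  then have "card ?P = card ?Q"
    by (rule bij_betw_same_card)
  then have "(2::nat) ^ card (orbit p ` insert a S) = 2 ^ card (orbit q ` S)"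
    using card_invariant[OF p, of "{..<2::nat}"] card_invariant[OF q, of "{..<2::nat}"] \<open>finite S\<close>
    by simp
  then show ?thesis
    by (simp add: p_def)
qed

lemma card_orbits_insert_fixpoint:
  assumes q: "q permutes S" and "finite S" "a \<notin> S"
  shows "card (orbit q ` insert a S) = Suc (card (orbit q ` S))"
proof -
  have "orbit q a = {a}"
    using q \<open>a \<notin> S\<close> by (auto simp: orbit_eq_singleton_iff permutes_def)
  moreover have "{a} \<notin> orbit q ` S"
    using permutes_orbit_subset[OF q] \<open>a \<notin> S\<close> by blast
  ultimately show ?thesis
    using \<open>finite S\<close> by simp
qed

text \<open>Removing \<open>a\<close> leaves two cases: a fixed point adds one element and one orbit
  and keeps the sign; a splice into an existing cycle adds one element, no orbit, and a
  transposition.\<close>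

lemma sign_eq_card_orbits:
  assumes "finite S" "p permutes S"
  shows "sign p = (-1) ^ card S * (-1) ^ card (orbit p ` S)"
  using assms
proof (induction S arbitrary: p rule: finite_induct)
  case empty
  then show ?case by simp
next
  case (insert a S)
  have "p \<in> {p. p permutes insert a S}"
    using insert.prems by simp
  then obtain b q where bq: "p = transpose a b \<circ> q" "b \<in> insert a S" "q permutes S"
    unfolding permutes_insert by (elim imageE CollectE case_prodE) auto
  have "permutation q"
    using bq(3) insert.hyps(1) permutation_permutes by blast
  then have sgn: "sign p = sign (transpose a b) * sign q"
    unfolding bq(1) by (intro sign_compose) (simp_all add: permutation_swap_id)
  show ?case
  proof (cases "b = a")
    case True
    then show ?thesis
      using insert.hyps insert.IH[OF bq(3)] card_orbits_insert_fixpoint[OF bq(3)] bq(1) by simp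
  next
    case False
    then have "b \<in> S" using bq(2) by simp
    then have "card (orbit p ` insert a S) = card (orbit q ` S)"
      unfolding bq(1) using card_orbits_transpose_insert[OF bq(3)] insert.hyps by blast
    moreover have "sign p = - sign q"
      using sgn False by (simp add: sign_swap_id)
    ultimately show ?thesis
      using insert.hyps insert.IH[OF bq(3)] by (simp del: image_insert)
  qed
qed

section \<open>D-permutations and colourings\<close>

lemma D_permutation_permutes: "D_permutation m \<sigma> \<Longrightarrow> \<sigma> permutes {1..m}"
  by (simp add: D_permutation_def)

lemma finite_D_permutations: "finite {\<sigma>. D_permutation m \<sigma>}"
  by (rule finite_subset[OF _ finite_permutations[of "{1..m}"]])
    (auto dest: D_permutation_permutes)

definition D_proper :: "nat \<Rightarrow> (nat \<Rightarrow> 'c) \<Rightarrow> bool" where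
  "D_proper m c \<longleftrightarrow>
     (\<forall>a\<in>{1..m}. \<forall>b\<in>{1..m}. odd a \<longrightarrow> even b \<longrightarrow> a < b \<longrightarrow> c a \<noteq> c b)"

text \<open>Properness forces \<open>\<sigma>\<close> to preserve parity, since a change of parity
  would give an edge with ends of equal colour. As \<open>\<sigma>\<close> is injective, never
  increases even vertices and never decreases odd ones, induction from below, respectively from
  above, makes every vertex fixed.\<close>

lemma D_permutation_invariant_proper:
  assumes \<sigma>: "D_permutation m \<sigma>" and inv: "\<forall>u\<in>{1..m}. c (\<sigma> u) = c u" and "D_proper m c"
  shows "\<sigma> = id"
proof -
  have perm: "\<sigma> permutes {1..m}"
    using \<sigma> by (rule D_permutation_permutes)
  have mem: "\<sigma> u \<in> {1..m}" if "u \<in> {1..m}" for u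
    using permutes_in_image[OF perm] that by blast
  have up: "i \<le> \<sigma> i" if "i \<in> {1..m}" "odd i" for i
    using \<sigma> that by (auto simp: D_permutation_def)
  have down: "\<sigma> i \<le> i" if "i \<in> {1..m}" "even i" for i
    using \<sigma> that by (auto simp: D_permutation_def)
  have proper: "c a \<noteq> c b" if "a \<in> {1..m}" "b \<in> {1..m}" "odd a" "even b" "a < b" for a b
    using \<open>D_proper m c\<close> that by (simp add: D_proper_def)
  have inj: "\<sigma> x = \<sigma> y \<Longrightarrow> x = y" for x y
    using permutes_inj[OF perm] by (auto dest: injD)
  have ev: "\<sigma> i = i" if "i \<in> {1..m}" "even i" for i
    using that
  proof (induction i rule: less_induct)
    case (less i)
    have "even (\<sigma> i)"
      using proper[OF mem[OF less.prems(1)] less.prems(1)] down less.prems inv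
      by (metis le_neq_implies_less)
    \<comment> \<open>If \<open>\<sigma> i < i\<close>, the induction hypothesis fixes
      \<open>\<sigma> i\<close>, and injectivity gives \<open>\<sigma> i = i\<close>.\<close>
    then show ?case
      using less.IH[of "\<sigma> i"] mem[OF less.prems(1)] down[OF less.prems] inj[of "\<sigma> i" i]
      by (cases "\<sigma> i = i") auto
  qed
  have od: "\<sigma> i = i" if "i \<in> {1..m}" "odd i" for i
    using that
  proof (induction "m - i" arbitrary: i rule: less_induct)
    case less
    have "odd (\<sigma> i)"
      using proper[OF less.prems(1) mem[OF less.prems(1)]] up less.prems inv
      by (metis le_neq_implies_less)
    then show ?case
      using less.hyps[of "\<sigma> i"] mem[OF less.prems(1)] up[OF less.prems] inj[of "\<sigma> i" i]
        less.prems(1)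
      by (cases "\<sigma> i = i") auto
  qed
  show ?thesis
  proof
    fix i show "\<sigma> i = id i"
      using ev od perm by (cases "i \<in> {1..m}") (auto simp: permutes_def)
  qed
qed

text \<open>Only the preimages of \<open>a\<close> and \<open>b\<close> get new values, and they
  have the colour of \<open>a\<close>. By \<open>gap\<close> they do not lie strictly between
  \<open>a\<close> and \<open>b\<close>, and parity excludes the critical endpoint, so exchanging
  the two values respects the inequalities.\<close>

lemma D_permutation_transpose:
  assumes \<sigma>: "D_permutation m \<sigma>" and inv: "\<forall>u\<in>{1..m}. c (\<sigma> u) = c u"
    and ab: "a \<in> {1..m}" "b \<in> {1..m}" "odd a" "even b" "a < b" "c a = c b"
    and gap: "\<forall>u. a < u \<and> u < b \<longrightarrow> c u \<noteq> c a"
  shows "D_permutation m (transpose a b \<circ> \<sigma>)"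
    and "\<forall>u\<in>{1..m}. c ((transpose a b \<circ> \<sigma>) u) = c u"
proof -
  show "\<forall>u\<in>{1..m}. c ((transpose a b \<circ> \<sigma>) u) = c u"
    using inv ab(6) by (metis comp_apply transpose_apply_first transpose_apply_other
      transpose_apply_second)
  have "(odd i \<longrightarrow> i \<le> transpose a b (\<sigma> i)) \<and> (even i \<longrightarrow> transpose a b (\<sigma> i) \<le> i)"
    if i: "i \<in> {1..m}" for i
  proof -
    have D: "(odd i \<longrightarrow> i \<le> \<sigma> i) \<and> (even i \<longrightarrow> \<sigma> i \<le> i)" and ci: "c (\<sigma> i) = c i"
      using \<sigma> inv i by (auto simp: D_permutation_def)
    consider "\<sigma> i = a" | "\<sigma> i = b" | "\<sigma> i \<noteq> a" "\<sigma> i \<noteq> b" by blast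
    then show ?thesis
    proof cases
      case 1
      then have "c i = c a" using ci by simp
      then have "\<not> (a < i \<and> i < b)" using gap by blast
      moreover have "even i \<Longrightarrow> i \<noteq> a" using \<open>odd a\<close> by blast
      ultimately show ?thesis using 1 D \<open>a < b\<close> by simp linarith
    next
      case 2
      then have "c i = c a" using ci ab by simp
      then have "\<not> (a < i \<and> i < b)" using gap by blast
      moreover have "odd i \<Longrightarrow> i \<noteq> b" using \<open>even b\<close> by blast
      ultimately show ?thesis using 2 D \<open>a < b\<close> by simp linarith
    next
      case 3
      with D show ?thesis by simp
    qed
  qed
  moreover have "transpose a b \<circ> \<sigma> permutes {1..m}"
    using ab by (intro permutes_compose[OF D_permutation_permutes[OF \<sigma>]] permutes_swap_id) auto
  ultimately show "D_permutation m (transpose a b \<circ> \<sigma>)"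
    by (simp add: D_permutation_def)
qed

text \<open>Take a violating pair at minimal distance: a vertex of the same colour in between would
  form a closer pair, with \<open>a\<close> if it is even and with \<open>b\<close> if it is
  odd.\<close>

lemma not_D_proper_closest:
  assumes "\<not> D_proper m c"
  obtains a b where "a \<in> {1..m}" "b \<in> {1..m}" "odd a" "even b" "a < b" "c a = c b"
    and "\<forall>u. a < u \<and> u < b \<longrightarrow> c u \<noteq> c a"
proof -
  define P where "P = (\<lambda>(a, b). a \<in> {1..m} \<and> b \<in> {1..m} \<and> odd a \<and> even b \<and> a < b \<and> c a = c b)"
  obtain a b where "P (a, b)"
    using assms unfolding D_proper_def P_def by blast
  then obtain e where e: "P e" and least: "\<And>e'. P e' \<Longrightarrow> snd e - fst e \<le> snd e' - fst e'"
    using ex_has_least_nat[of P _ "\<lambda>e. snd e - fst e"] by metis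
  obtain a b where [simp]: "e = (a, b)" by fastforce
  have "c u \<noteq> c a" if u: "a < u" "u < b" for u
  proof
    assume cu: "c u = c a"
    show False
    proof (cases "even u")
      case True
      then have "P (a, u)" using e u cu by (auto simp: P_def)
      from least[OF this] u show False by simp
    next
      case False
      then have "P (u, b)" using e u cu by (auto simp: P_def)
      from least[OF this] u show False by simp
    qed
  qed
  with e show thesis by (intro that[of a b]) (auto simp: P_def)
qed

text \<open>
  This sum is the determinant of the 0-1 matrix with entry 1 at \<open>(i, j)\<close> iff \<open>c i = c j\<close> and a
  D-permutation may map \<open>i\<close> to \<open>j\<close>. If an odd \<open>a\<close> and a larger even \<open>b\<close> of the same colour are at
  minimal distance, then the columns \<open>a\<close> and \<open>b\<close> agree.
\<close>

lemma sum_sign_invariant_D_permutations: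
  "(\<Sum>\<sigma> | D_permutation m \<sigma> \<and> (\<forall>u\<in>{1..m}. c (\<sigma> u) = c u). sign \<sigma>) =
     (if D_proper m c then 1 else 0)"
    (is "sum _ ?D = _")
proof (cases "D_proper m c")
  case True
  then have "\<sigma> = id" if "\<sigma> \<in> ?D" for \<sigma>
    using D_permutation_invariant_proper that by blast
  moreover have "id \<in> ?D"
    by (simp add: D_permutation_def permutes_id)
  ultimately have "?D = {id}"
    by blast
  with True show ?thesis by simp
next
  case False
  then obtain a b where ab: "a \<in> {1..m}" "b \<in> {1..m}" "odd a" "even b" "a < b" "c a = c b"
    and gap: "\<forall>u. a < u \<and> u < b \<longrightarrow> c u \<noteq> c a"
    by (rule not_D_proper_closest)
  let ?f = "\<lambda>\<sigma>. transpose a b \<circ> \<sigma>"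
  have closed: "?f \<sigma> \<in> ?D" if "\<sigma> \<in> ?D" for \<sigma>
    using D_permutation_transpose[OF _ _ ab gap, of \<sigma>] that by blast
  have invol: "?f (?f \<sigma>) = \<sigma>" for \<sigma> :: "nat \<Rightarrow> nat"
    by (simp add: fun_eq_iff)
  have sign: "sign (?f \<sigma>) = - sign \<sigma>" if "\<sigma> \<in> ?D" for \<sigma>
  proof -
    have "permutation \<sigma>"
      using that D_permutation_permutes permutation_permutes by blast
    then show ?thesis
      using \<open>a < b\<close> by (simp add: sign_compose permutation_swap_id sign_swap_id)
  qed
  have "(\<Sum>\<sigma>\<in>?D. sign \<sigma>) = (\<Sum>\<sigma>\<in>?D. - sign \<sigma>)"
    by (rule sum.reindex_bij_witness[of _ ?f ?f]) (simp_all only: invol closed sign minus_minus)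
  also have "\<dots> = - (\<Sum>\<sigma>\<in>?D. sign \<sigma>)"
    by (rule sum_negf)
  finally show ?thesis
    using False by simp
qed

lemma card_D_proper:
  "int (card {c \<in> {1..m} \<rightarrow>\<^sub>E {..<t::nat}. D_proper m c}) =
     (\<Sum>\<sigma> | D_permutation m \<sigma>. sign \<sigma> * int t ^ num_cycles m \<sigma>)"
proof -
  let ?C = "{1..m} \<rightarrow>\<^sub>E {..<t}" and ?D = "{\<sigma>. D_permutation m \<sigma>}"
  have fin: "finite ?C" by (simp add: finite_PiE)
  have "int (card {c \<in> ?C. D_proper m c}) = (\<Sum>c\<in>?C. if D_proper m c then 1 else 0)"
    using fin by (simp add: sum.If_cases Int_def)
  also have "\<dots> = (\<Sum>c\<in>?C. \<Sum>\<sigma>\<in>?D. if \<forall>u\<in>{1..m}. c (\<sigma> u) = c u then sign \<sigma> else 0)"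
    by (simp add: sum_sign_invariant_D_permutations[symmetric] sum.inter_filter[symmetric]
        finite_D_permutations)
  also have "\<dots> = (\<Sum>\<sigma>\<in>?D. \<Sum>c\<in>?C. if \<forall>u\<in>{1..m}. c (\<sigma> u) = c u then sign \<sigma> else 0)"
    by (rule sum.swap)
  also have "\<dots> = (\<Sum>\<sigma>\<in>?D. sign \<sigma> * int t ^ num_cycles m \<sigma>)"
  proof (rule sum.cong)
    fix \<sigma> assume "\<sigma> \<in> ?D"
    then have "card {c \<in> ?C. \<forall>u\<in>{1..m}. c (\<sigma> u) = c u} = t ^ num_cycles m \<sigma>"
      using card_invariant[OF D_permutation_permutes, of m \<sigma> "{..<t}"] by (simp add: num_cycles_def)
    moreover have "(\<Sum>c\<in>?C. if \<forall>u\<in>{1..m}. c (\<sigma> u) = c u then sign \<sigma> else 0) =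
        sign \<sigma> * int (card {c \<in> ?C. \<forall>u\<in>{1..m}. c (\<sigma> u) = c u})"
      using fin by (simp add: sum.inter_filter[symmetric])
    ultimately show "(\<Sum>c\<in>?C. if \<forall>u\<in>{1..m}. c (\<sigma> u) = c u then sign \<sigma> else 0) =
        sign \<sigma> * int t ^ num_cycles m \<sigma>"
      by simp
  qed simp
  finally show ?thesis .
qed

lemma num_cycles_bounds:
  assumes "m \<ge> 1"
  shows "num_cycles m \<sigma> \<in> {1..m}"
proof -
  have "card (orbit \<sigma> ` {1..m}) \<le> card {1..m}" by (rule card_image_le) simp
  moreover have "card (orbit \<sigma> ` {1..m}) > 0"
    using assms by (simp add: card_gt_0_iff)
  ultimately show ?thesis by (simp add: num_cycles_def)
qed

lemma card_D_proper_s_D: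
  assumes "n \<ge> 1"
  shows "int (card {c \<in> {1..2*n} \<rightarrow>\<^sub>E {..<t::nat}. D_proper (2*n) c}) =
    (\<Sum>k=1..2*n. s_D (2*n) k * int t ^ k)"
proof -
  let ?D = "{\<sigma>. D_permutation (2*n) \<sigma>}"
  have "(\<Sum>\<sigma>\<in>?D. sign \<sigma> * int t ^ num_cycles (2*n) \<sigma>) =
      (\<Sum>k=1..2*n. \<Sum>\<sigma> | \<sigma> \<in> ?D \<and> num_cycles (2*n) \<sigma> = k. sign \<sigma> * int t ^ num_cycles (2*n) \<sigma>)"
    using num_cycles_bounds[of "2*n"] assms
    by (intro sum.group[symmetric] finite_D_permutations) (auto simp del: One_nat_def)
  also have "\<dots> = (\<Sum>k=1..2*n. s_D (2*n) k * int t ^ k)"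
  proof (rule sum.cong)
    fix k assume "k \<in> {1..2*n}"
    \<comment> \<open>The ground set has even size, so the number of cycles alone determines the
      sign.\<close>
    have "sign \<sigma> = (-1) ^ k" if "D_permutation (2*n) \<sigma>" "num_cycles (2*n) \<sigma> = k" for \<sigma>
      using sign_eq_card_orbits[OF _ D_permutation_permutes[OF that(1)]] that(2)
      by (simp add: num_cycles_def)
    then have "(\<Sum>\<sigma> | \<sigma> \<in> ?D \<and> num_cycles (2*n) \<sigma> = k. sign \<sigma> * int t ^ num_cycles (2*n) \<sigma>) =
        (\<Sum>\<sigma> | \<sigma> \<in> ?D \<and> num_cycles (2*n) \<sigma> = k. (-1) ^ k * int t ^ k)"
      by (intro sum.cong) auto
    then show "(\<Sum>\<sigma> | \<sigma> \<in> ?D \<and> num_cycles (2*n) \<sigma> = k. sign \<sigma> * int t ^ num_cycles (2*n) \<sigma>) =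
        s_D (2*n) k * int t ^ k"
      by (simp add: s_D_def)
  qed simp
  finally show ?thesis
    unfolding card_D_proper .
qed


section \<open>Moebius functions and ranks\<close>

lemma sum_moebius_below:
  assumes r: "finite r" "Partial_order r" "(x, y) \<in> r"
  shows "(\<Sum>z | (x, z) \<in> r \<and> (z, y) \<in> r. moebius r x z) = (if x = y then 1 else 0)"
proof -
  have refl: "(z, z) \<in> r" if "z \<in> Field r" for z
    using r that by (auto simp: partial_order_on_def preorder_on_def refl_on_def)
  have fin: "finite {z. (x, z) \<in> r \<and> (z, y) \<in> r}"
    by (rule finite_subset[OF _ finite_Field[OF r(1)]]) (auto intro: FieldI1)
  have yy: "(y, y) \<in> r" "(x, x) \<in> r"
    using r(3) refl by (auto intro: FieldI1 FieldI2)
  show ?thesis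
  proof (cases "x = y")
    case True
    have "{z. (x, z) \<in> r \<and> (z, y) \<in> r} = {x}"
      using r(2) yy True by (auto simp: partial_order_on_def dest: antisymD)
    then show ?thesis
      using True r by (simp add: moebius.simps)
  next
    case False
    have "{z. (x, z) \<in> r \<and> (z, y) \<in> r} =
        insert y {z. (x, z) \<in> r \<and> (z, y) \<in> r \<and> z \<noteq> y}"
      using r(3) yy by auto
    then have "(\<Sum>z | (x, z) \<in> r \<and> (z, y) \<in> r. moebius r x z) =
        moebius r x y + (\<Sum>z | (x, z) \<in> r \<and> (z, y) \<in> r \<and> z \<noteq> y. moebius r x z)"
      using fin by simp
    also have "moebius r x y = - (\<Sum>z | (x, z) \<in> r \<and> (z, y) \<in> r \<and> z \<noteq> y. moebius r x z)"
      using r False by (subst moebius.simps) simp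
    finally show ?thesis
      using False by simp
  qed
qed

lemma poset_length_eq_rank_top:
  assumes "\<And>x. x \<in> Field r \<Longrightarrow> (x, y) \<in> r"
  shows "poset_length r = poset_rank r y"
proof -
  \<comment> \<open>Comparing \<open>c\<close> with itself in the chain puts it into the field of
    \<open>r\<close>.\<close>
  have "(c, y) \<in> r" if "C \<in> Chains r" "c \<in> C" for C c
    using that assms unfolding Chains_def by (blast intro: FieldI1)
  then have "{card C - 1 | C. C \<in> Chains r \<and> C \<noteq> {}} =
      {card C - 1 | C. C \<in> Chains r \<and> C \<noteq> {} \<and> (\<forall>c\<in>C. (c, y) \<in> r)}"
    by blast
  then show ?thesis
    by (simp add: poset_length_def poset_rank_def)
qed

section \<open>Graphical arrangements\<close>

text \<open>
  The points of \<open>V\<close> are only required to project onto all real-valued functions on the vertex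
  set \<open>S\<close>, so that directions irrelevant to all hyperplanes are allowed in \<open>V\<close>.
\<close>

locale graphical_arrangement =
  fixes V :: "'p set" and coord :: "'p \<Rightarrow> 'v \<Rightarrow> real"
    and S :: "'v set" and G :: "('v \<times> 'v) set"
  assumes finite_vertices: "finite S"
    and edges: "G \<subseteq> S \<times> S"
    and coord_surj: "\<exists>p\<in>V. \<forall>v\<in>S. coord p v = c v"
begin

section \<open>Flats, their blocks, and colourings as points\<close>

definition hyp :: "'v \<times> 'v \<Rightarrow> 'p set" where
  "hyp e = {p \<in> V. coord p (fst e) = coord p (snd e)}"

abbreviation "flats \<equiv> intersections V (hyp ` G)"
abbreviation "lat \<equiv> intersection_lattice V (hyp ` G)"

text \<open>A lift of a colouring to \<open>V\<close>. Which lift is chosen does not affect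
  membership in flats, as these constrain only the coordinates on \<open>S\<close>.\<close>

definition point :: "('v \<Rightarrow> real) \<Rightarrow> 'p" where
  "point c = (SOME p. p \<in> V \<and> (\<forall>v\<in>S. coord p v = c v))"

definition block :: "'p set \<Rightarrow> 'v \<Rightarrow> 'v set" where
  "block X u = {v \<in> S. \<forall>p\<in>X. coord p u = coord p v}"

text \<open>For a flat, this is the dimension of its image under \<open>coord\<close> in the real
  functions on \<open>S\<close>.\<close>

definition nblocks :: "'p set \<Rightarrow> nat" where
  "nblocks X = card (block X ` S)"

lemma point: "point c \<in> V" "v \<in> S \<Longrightarrow> coord (point c) v = c v"
proof -
  have "point c \<in> V \<and> (\<forall>v\<in>S. coord (point c) v = c v)"
    unfolding point_def by (rule someI_ex) (use coord_surj[of c] in blast)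
  then show "point c \<in> V" "v \<in> S \<Longrightarrow> coord (point c) v = c v" by auto
qed

lemma finite_G: "finite G"
  using edges finite_vertices finite_subset by blast

lemma finite_flats: "finite flats"
proof -
  have "flats = (\<lambda>\<B>. V \<inter> \<Inter>\<B>) ` Pow (hyp ` G)"
    by (auto simp: intersections_def)
  then show ?thesis
    by (simp add: finite_G)
qed

lemma finite_lat: "finite lat"
  by (rule finite_subset[of _ "flats \<times> flats"])
    (auto simp: intersection_lattice_def finite_flats)

lemma lat_iff: "(X, Y) \<in> lat \<longleftrightarrow> X \<in> flats \<and> Y \<in> flats \<and> Y \<subseteq> X"
  by (auto simp: intersection_lattice_def)

lemma flat_subset: "X \<in> flats \<Longrightarrow> X \<subseteq> V"
  by (auto simp: intersections_def)

lemma space_flat: "V \<in> flats"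
  by (auto simp: intersections_def intro!: exI[of _ "{}"])

lemma flat_Int_hyp:
  assumes "X \<in> flats" "e \<in> G"
  shows "X \<inter> hyp e \<in> flats"
proof -
  obtain \<B> where "X = V \<inter> \<Inter>\<B>" "\<B> \<subseteq> hyp ` G"
    using assms by (auto simp: intersections_def)
  then have "X \<inter> hyp e = V \<inter> \<Inter>(insert (hyp e) \<B>)" "insert (hyp e) \<B> \<subseteq> hyp ` G"
    using assms by auto
  then show ?thesis
    unfolding intersections_def by blast
qed

lemma block_eq_iff:
  assumes "u \<in> S" "v \<in> S"
  shows "block X u = block X v \<longleftrightarrow> (\<forall>p\<in>X. coord p u = coord p v)"
proof
  assume "block X u = block X v"
  moreover have "v \<in> block X v" using assms by (simp add: block_def)
  ultimately show "\<forall>p\<in>X. coord p u = coord p v" by (auto simp: block_def)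
qed (auto simp: block_def)

lemma flat_subset_hyp:
  assumes "X \<in> flats" "Y \<in> flats" "\<not> X \<subseteq> Y"
  obtains e where "e \<in> G" "Y \<subseteq> hyp e" "\<not> X \<subseteq> hyp e"
proof -
  obtain \<B> where "Y = V \<inter> \<Inter>\<B>" "\<B> \<subseteq> hyp ` G"
    using assms by (auto simp: intersections_def)
  moreover obtain p where "p \<in> X" "p \<notin> Y"
    using assms by blast
  ultimately obtain e where "e \<in> G" "hyp e \<in> \<B>" "p \<notin> hyp e"
    using flat_subset[OF assms(1)] by blast
  then show thesis
    using that \<open>Y = V \<inter> \<Inter>\<B>\<close> \<open>p \<in> X\<close> by blast
qed

text \<open>A flat is recovered from its blocks: each hyperplane defining \<open>X\<close> contains
  \<open>X\<close>, so the ends of its edge share a block, and constancy on blocks implies the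
  equation of the hyperplane.\<close>

lemma point_mem_flat_iff:
  assumes X: "X \<in> flats"
  shows "point c \<in> X \<longleftrightarrow> (\<forall>u\<in>S. \<forall>v\<in>S. block X u = block X v \<longrightarrow> c u = c v)"
proof
  assume "point c \<in> X"
  then show "\<forall>u\<in>S. \<forall>v\<in>S. block X u = block X v \<longrightarrow> c u = c v"
    using block_eq_iff point by metis
next
  assume *: "\<forall>u\<in>S. \<forall>v\<in>S. block X u = block X v \<longrightarrow> c u = c v"
  obtain \<B> where \<B>: "X = V \<inter> \<Inter>\<B>" "\<B> \<subseteq> hyp ` G"
    using X by (auto simp: intersections_def)
  have "point c \<in> H" if H: "H \<in> \<B>" for H
  proof -
    obtain a b where ab: "(a, b) \<in> G" "H = hyp (a, b)"
      using H \<B>(2) by auto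
    then have S: "a \<in> S" "b \<in> S" using edges by auto
    have "X \<subseteq> H" using \<B>(1) H by blast
    then have "block X a = block X b"
      unfolding block_eq_iff[OF S] ab(2) hyp_def by auto
    then have "c a = c b"
      using * S by blast
    then show ?thesis
      using S ab(2) by (simp add: hyp_def point)
  qed
  then show "point c \<in> X"
    using \<B>(1) point(1) by blast
qed

lemma card_colourings_in_flat:
  assumes "X \<in> flats"
  shows "card {c \<in> S \<rightarrow>\<^sub>E {..<t::nat}. point (real \<circ> c) \<in> X} = t ^ nblocks X"
  using card_PiE_factoring[OF finite_vertices, of "{..<t}" "block X"]
  by (simp add: point_mem_flat_iff[OF assms] nblocks_def)

lemma nblocks_le: "nblocks X \<le> card S"
  unfolding nblocks_def using finite_vertices by (rule card_image_le)

lemma nblocks_space: "nblocks V = card S"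
proof -
  have "inj_on (block V) S"
  proof (rule inj_onI)
    fix u v assume uv: "u \<in> S" "v \<in> S" "block V u = block V v"
    \<comment> \<open>The indicator function of \<open>u\<close> separates \<open>u\<close> from
      every other vertex.\<close>
    let ?p = "point (\<lambda>w. if w = u then 1 else 0)"
    have "coord ?p u = coord ?p v"
      using uv block_eq_iff point(1) by blast
    then show "u = v"
      using uv by (simp add: point split: if_splits)
  qed
  then show ?thesis
    unfolding nblocks_def by (rule card_image)
qed

text \<open>Blocks of \<open>Y\<close> are unions of blocks of \<open>X\<close>, so \<open>h\<close>
  maps the latter onto the former. It is not injective: some edge has its ends merged in
  \<open>Y\<close> but not in \<open>X\<close>.\<close>

lemma nblocks_strict_mono:
  assumes X: "X \<in> flats" and Y: "Y \<in> flats" and "Y \<subset> X"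
  shows "nblocks Y < nblocks X"
proof -
  obtain e where e: "e \<in> G" "Y \<subseteq> hyp e" "\<not> X \<subseteq> hyp e"
    using flat_subset_hyp[OF X Y] \<open>Y \<subset> X\<close> by blast
  obtain a b where ab: "e = (a, b)" by fastforce
  then have S: "a \<in> S" "b \<in> S" using e edges by auto
  define h where "h = (\<lambda>B. block Y (SOME u. u \<in> S \<and> block X u = B))"
  have h: "h (block X u) = block Y u" if u: "u \<in> S" for u
  proof -
    let ?w = "SOME w. w \<in> S \<and> block X w = block X u"
    have w: "?w \<in> S \<and> block X ?w = block X u"
      by (rule someI[of _ u]) (use u in simp)
    then have "\<forall>p\<in>Y. coord p ?w = coord p u"
      using block_eq_iff[of ?w u X] u \<open>Y \<subset> X\<close> by blast
    then show ?thesis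
      using block_eq_iff[of ?w u Y] w u by (simp add: h_def)
  qed
  have img: "h ` block X ` S = block Y ` S"
    using h by (force simp: image_image)
  have "block X a \<noteq> block X b"
    using e flat_subset[OF X] S by (auto simp: ab hyp_def block_eq_iff)
  moreover have "h (block X a) = h (block X b)"
    using e S by (auto simp: ab hyp_def h block_eq_iff)
  ultimately have "\<not> inj_on h (block X ` S)"
    using S by (auto simp: inj_on_def)
  then have "card (h ` block X ` S) \<noteq> card (block X ` S)"
    using finite_vertices by (meson eq_card_imp_inj_on finite_imageI)
  moreover have "card (h ` block X ` S) \<le> card (block X ` S)"
    using finite_vertices by (intro card_image_le) simp
  ultimately show ?thesis
    unfolding img nblocks_def by simp
qed

text \<open>
  Intersecting with the hyperplane of an edge \<open>(a, b)\<close> merges at most the blocks of \<open>a\<close> and \<open>b\<close>: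
  two other blocks are separated by the indicator function of one of them.
\<close>

lemma nblocks_Int_hyp:
  assumes X: "X \<in> flats" and e: "e \<in> G"
  shows "nblocks X \<le> Suc (nblocks (X \<inter> hyp e))"
proof -
  obtain a b where ab: "e = (a, b)" by fastforce
  then have S: "a \<in> S" "b \<in> S" using e edges by auto
  let ?Y = "X \<inter> hyp e"
  have sep: "block ?Y u \<noteq> block ?Y v"
    if uv: "u \<in> S" "v \<in> S" "block X u \<noteq> block X v"
      "block X u \<noteq> block X a" "block X u \<noteq> block X b" for u v
  proof -
    define c :: "'v \<Rightarrow> real" where "c = (\<lambda>w. if block X w = block X u then 1 else 0)"
    have "point c \<in> X"
      unfolding point_mem_flat_iff[OF X] by (simp add: c_def)
    moreover have "point c \<in> hyp e"
      using S uv by (auto simp: ab hyp_def point c_def)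
    moreover have "coord (point c) u \<noteq> coord (point c) v"
      using uv by (simp add: point c_def)
    ultimately show ?thesis
      using block_eq_iff[of u v ?Y] uv by blast
  qed
  define g where "g = (\<lambda>B. block ?Y (inv_into S (block X) B))"
  let ?R = "block X ` S - {block X a}"
  have "inj_on g ?R"
  proof (rule inj_onI, rule ccontr)
    fix B C assume BC: "B \<in> ?R" "C \<in> ?R" "g B = g C" "B \<noteq> C"
    define u v where "u = inv_into S (block X) B" and "v = inv_into S (block X) C"
    have u: "u \<in> S" "block X u = B" and v: "v \<in> S" "block X v = C"
      using BC unfolding u_def v_def by (auto simp: inv_into_into f_inv_into_f)
    have eq: "block ?Y u = block ?Y v"
      using BC(3) by (simp add: g_def u_def v_def)
    show False
    \<comment> \<open>The first vertex given to \<open>sep\<close> must avoid the blocks of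
      \<open>a\<close> and \<open>b\<close>. The former is removed from \<open>?R\<close>, and at
      most one of \<open>B\<close> and \<open>C\<close> is the latter.\<close>
    proof (cases "B = block X b")
      case True
      then show False
        using sep[OF v(1) u(1)] u v BC eq by auto
    next
      case False
      then show False
        using sep[OF u(1) v(1)] u v BC eq by auto
    qed
  qed
  moreover have "g ` ?R \<subseteq> block ?Y ` S"
    by (auto simp: g_def intro!: imageI inv_into_into)
  ultimately have "card ?R \<le> nblocks ?Y"
    unfolding nblocks_def using finite_vertices by (intro card_inj_on_le) auto
  moreover have "card ?R = nblocks X - 1"
    unfolding nblocks_def using S finite_vertices by (simp add: card_Diff_singleton)
  ultimately show ?thesis by simp
qed

section \<open>Rank and length of the lattice of flats\<close>

lemma chain_card_le:
  assumes C: "C \<in> Chains lat" "C \<noteq> {}" "\<forall>D\<in>C. (D, X) \<in> lat"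
  shows "card C - 1 \<le> card S - nblocks X"
proof -
  have sub: "D \<in> flats" "X \<subseteq> D" if "D \<in> C" for D
    using C that by (auto simp: lat_iff)
  have X: "X \<in> flats"
    using C by (auto simp: lat_iff)
  have "inj_on nblocks C"
  proof (rule inj_onI, rule ccontr)
    fix D E assume DE: "D \<in> C" "E \<in> C" "nblocks D = nblocks E" "D \<noteq> E"
    then have "D \<subset> E \<or> E \<subset> D"
      using C(1) by (auto simp: Chains_def lat_iff)
    then show False
      using nblocks_strict_mono sub DE by (metis less_irrefl)
  qed
  moreover have "nblocks X \<le> nblocks D" if "D \<in> C" for D
    using nblocks_strict_mono[OF sub(1)[OF that] X] sub(2)[OF that]
    by (metis less_imp_le order_refl psubsetI)
  then have "nblocks ` C \<subseteq> {nblocks X..card S}"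
    using nblocks_le by auto
  ultimately have "card C \<le> card {nblocks X..card S}"
    by (intro card_inj_on_le) auto
  then show ?thesis
    using nblocks_le[of X] by simp
qed

text \<open>Impose the hyperplanes of \<open>F\<close> one at a time. Each either leaves the flat
  unchanged or extends the chain by one flat while losing at most one block, so the chain is long
  enough.\<close>

lemma chain_exists:
  assumes "finite F" "F \<subseteq> G"
  shows "\<exists>C\<in>Chains lat. C \<noteq> {} \<and> finite C \<and> (\<forall>D\<in>C. (D, V \<inter> \<Inter>(hyp ` F)) \<in> lat) \<and>
    card S \<le> card C - 1 + nblocks (V \<inter> \<Inter>(hyp ` F))"
  using assms
proof (induction F rule: finite_induct)
  case empty
  have "{V} \<in> Chains lat"
    by (auto simp: Chains_def lat_iff space_flat)
  then show ?case
    by (intro bexI[of _ "{V}"]) (auto simp: lat_iff space_flat nblocks_space)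
next
  case (insert e F)
  let ?X = "V \<inter> \<Inter>(hyp ` F)"
  obtain C where C: "C \<in> Chains lat" "C \<noteq> {}" "finite C" "\<forall>D\<in>C. (D, ?X) \<in> lat"
      and card: "card S \<le> card C - 1 + nblocks ?X"
    using insert by auto
  have Y: "V \<inter> \<Inter>(hyp ` insert e F) = ?X \<inter> hyp e"
    by auto
  have X: "?X \<in> flats"
    using C by (auto simp: lat_iff)
  show ?case
  proof (cases "?X \<subseteq> hyp e")
    case True
    then show ?thesis
      unfolding Y using C card by (intro bexI[of _ C]) (auto simp: Int_absorb2)
  next
    case False
    let ?C = "insert (?X \<inter> hyp e) C"
    have XY: "?X \<inter> hyp e \<in> flats"
      using X insert.prems by (intro flat_Int_hyp) auto
    have below: "\<forall>D\<in>?C. (D, ?X \<inter> hyp e) \<in> lat"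
      using C XY by (auto simp: lat_iff)
    then have "?C \<in> Chains lat"
      using C(1) by (auto simp: Chains_def)
    moreover have "?X \<inter> hyp e \<notin> C"
      using C(4) False by (auto simp: lat_iff)
    \<comment> \<open>Positivity makes the truncated \<open>card C - 1\<close> grow by exactly
      one.\<close>
    moreover have "card C > 0"
      using C by (simp add: card_gt_0_iff)
    moreover have "nblocks ?X \<le> Suc (nblocks (?X \<inter> hyp e))"
      using X insert.prems by (intro nblocks_Int_hyp) auto
    ultimately show ?thesis
      unfolding Y using below C(3) card by (intro bexI[of _ ?C]) auto
  qed
qed

text \<open>The rank is the codimension: strictly decreasing block counts bound every chain, and
  adding hyperplanes singly attains the bound.\<close>

lemma poset_rank_flat:
  assumes X: "X \<in> flats"
  shows "poset_rank lat X = card S - nblocks X"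
  unfolding poset_rank_def
proof (rule Max_eqI)
  let ?M = "{card C - 1 |C. C \<in> Chains lat \<and> C \<noteq> {} \<and> (\<forall>c\<in>C. (c, X) \<in> lat)}"
  show le: "k \<le> card S - nblocks X" if "k \<in> ?M" for k
    using chain_card_le that by blast
  then show "finite ?M"
    by (meson finite_nat_set_iff_bounded_le)
  obtain \<B> where "X = V \<inter> \<Inter>\<B>" "\<B> \<subseteq> hyp ` G"
    using X by (auto simp: intersections_def)
  then obtain F where F: "F \<subseteq> G" "X = V \<inter> \<Inter>(hyp ` F)"
    unfolding subset_image_iff by blast
  then obtain C where "C \<in> Chains lat" "C \<noteq> {}" "\<forall>D\<in>C. (D, X) \<in> lat"
      "card S \<le> card C - 1 + nblocks X"
    using chain_exists[of F] finite_subset[OF F(1) finite_G] by blast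
  moreover from this have "card C - 1 \<le> card S - nblocks X"
    by (intro chain_card_le)
  ultimately have "card C - 1 = card S - nblocks X"
    by simp
  with \<open>C \<in> Chains lat\<close> \<open>C \<noteq> {}\<close> \<open>\<forall>D\<in>C. (D, X) \<in> lat\<close> show "card S - nblocks X \<in> ?M"
    by (intro CollectI exI[of _ C]) simp
qed

text \<open>The greatest element of \<open>lat\<close>, whose order is reverse inclusion; its rank
  is the length of the lattice.\<close>

definition centre :: "'p set" where
  "centre = V \<inter> \<Inter>(hyp ` G)"

lemma centre_flat: "centre \<in> flats"
  by (auto simp: centre_def intersections_def)

lemma centre_subset: "X \<in> flats \<Longrightarrow> centre \<subseteq> X"
  by (auto simp: centre_def intersections_def)

lemma nblocks_centre_le:
  assumes "X \<in> flats"
  shows "nblocks centre \<le> nblocks X"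
  using nblocks_strict_mono[OF assms centre_flat] centre_subset[OF assms]
  by (metis less_imp_le order_refl psubsetI)

lemma poset_length_lat: "poset_length lat = card S - nblocks centre"
proof -
  have "poset_length lat = poset_rank lat centre"
    using centre_flat centre_subset
    by (intro poset_length_eq_rank_top) (auto simp: Field_intersection_lattice lat_iff)
  then show ?thesis
    by (simp add: poset_rank_flat centre_flat)
qed

text \<open>
  Moebius inversion: the flats containing a point are those above which a smallest flat
  through the point lies, and this smallest flat is the whole space iff the point is on no
  hyperplane.
\<close>

lemma sum_moebius_point:
  assumes loopfree: "\<forall>(a, b)\<in>G. a \<noteq> b"
  shows "(\<Sum>X | X \<in> flats \<and> point c \<in> X. moebius lat V X) = (if \<forall>(a, b)\<in>G. c a \<noteq> c b then 1 else 0)"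
proof -
  let ?Y = "V \<inter> \<Inter>(hyp ` {e \<in> G. point c \<in> hyp e})"
  have Y: "?Y \<in> flats"
    by (auto simp: intersections_def)
  have "X \<in> flats \<and> point c \<in> X \<longleftrightarrow> (V, X) \<in> lat \<and> (X, ?Y) \<in> lat" for X
  proof
    assume X: "X \<in> flats \<and> point c \<in> X"
    then obtain \<B> where \<B>: "X = V \<inter> \<Inter>\<B>" "\<B> \<subseteq> hyp ` G"
      by (auto simp: intersections_def)
    then have "\<B> \<subseteq> hyp ` {e \<in> G. point c \<in> hyp e}"
      using X by blast
    then have "?Y \<subseteq> X"
      unfolding \<B>(1) by blast
    then show "(V, X) \<in> lat \<and> (X, ?Y) \<in> lat"
      using X Y by (auto simp: lat_iff space_flat dest: flat_subset)
  next
    assume "(V, X) \<in> lat \<and> (X, ?Y) \<in> lat"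
    then show "X \<in> flats \<and> point c \<in> X"
      using point(1)[of c] by (auto simp: lat_iff)
  qed
  then have "(\<Sum>X | X \<in> flats \<and> point c \<in> X. moebius lat V X) =
      (\<Sum>X | (V, X) \<in> lat \<and> (X, ?Y) \<in> lat. moebius lat V X)"
    by simp
  also have "\<dots> = (if V = ?Y then 1 else 0)"
    using Y by (intro sum_moebius_below finite_lat Partial_order_intersection_lattice)
      (auto simp: lat_iff space_flat)
  also have "V = ?Y \<longleftrightarrow> (\<forall>(a, b)\<in>G. c a \<noteq> c b)"
  proof
    assume proper: "\<forall>(a, b)\<in>G. c a \<noteq> c b"
    have "point c \<notin> hyp e" if e: "e \<in> G" for e
    proof -
      obtain a b where "e = (a, b)" by fastforce
      with e proper have "c a \<noteq> c b" by blast
      moreover have "a \<in> S" "b \<in> S" using e edges \<open>e = (a, b)\<close> by auto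
      ultimately show ?thesis using \<open>e = (a, b)\<close> by (simp add: hyp_def point(2))
    qed
    then have empty: "{e \<in> G. point c \<in> hyp e} = {}" by blast
    show "V = ?Y" unfolding empty by simp
  next
    assume V: "V = ?Y"
    show "\<forall>(a, b)\<in>G. c a \<noteq> c b"
    proof clarify
      fix a b assume ab: "(a, b) \<in> G" "c a = c b"
      then have S: "a \<in> S" "b \<in> S" "a \<noteq> b" using edges loopfree by auto
      then have "point c \<in> hyp (a, b)"
        using ab by (simp add: hyp_def point)
      then have "V \<subseteq> hyp (a, b)"
        using V ab by blast
      \<comment> \<open>The indicator of \<open>a\<close> lies off the hyperplane of
        \<open>(a, b)\<close>, because the edge is not a loop.\<close>
      moreover let ?p = "point (\<lambda>w. if w = a then 1 else 0)"
      have "?p \<in> V" by (rule point(1))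
      ultimately have "coord ?p a = coord ?p b"
        by (auto simp: hyp_def)
      then show False
        using S by (simp add: point)
    qed
  qed
  finally show ?thesis .
qed

text \<open>The exponent of \<open>X\<close> in the characteristic polynomial is
  \<open>nblocks X - nblocks centre\<close>, which explains the extra power of \<open>t\<close>.
  Then \<open>t ^ nblocks X\<close> counts the colourings lying in \<open>X\<close>, and after
  exchanging sums Moebius inversion retains those on no hyperplane.\<close>

theorem char_poly_chromatic:
  assumes loopfree: "\<forall>(a, b)\<in>G. a \<noteq> b"
  shows "int t ^ nblocks centre * poly (char_poly_poset lat) (int t) =
    int (card {c \<in> S \<rightarrow>\<^sub>E {..<t}. \<forall>(a, b)\<in>G. c a \<noteq> c b})"
proof -
  let ?C = "S \<rightarrow>\<^sub>E {..<t}"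
  have fin: "finite ?C"
    using finite_vertices by (simp add: finite_PiE)
  have exp: "nblocks centre + (poset_length lat - poset_rank lat X) = nblocks X"
    if "X \<in> flats" for X
    using that nblocks_le[of X] nblocks_le[of centre] nblocks_centre_le[OF that]
    by (simp add: poset_length_lat poset_rank_flat)
  have "int t ^ nblocks centre * poly (char_poly_poset lat) (int t) =
      (\<Sum>X\<in>flats. moebius lat V X *
        (int t ^ nblocks centre * int t ^ (poset_length lat - poset_rank lat X)))"
    by (simp add: char_poly_poset_def poset_bot_intersection_lattice Field_intersection_lattice
        poly_sum poly_monom sum_distrib_left mult_ac)
  also have "\<dots> = (\<Sum>X\<in>flats. moebius lat V X * int t ^ nblocks X)"
    by (intro sum.cong) (simp_all add: exp flip: power_add)
  also have "\<dots> = (\<Sum>X\<in>flats. \<Sum>c\<in>?C. if point (real \<circ> c) \<in> X then moebius lat V X else 0)"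
    using fin by (intro sum.cong)
      (simp_all add: sum.inter_filter[symmetric] card_colourings_in_flat)
  also have "\<dots> = (\<Sum>c\<in>?C. \<Sum>X\<in>flats. if point (real \<circ> c) \<in> X then moebius lat V X else 0)"
    by (rule sum.swap)
  also have "\<dots> = (\<Sum>c\<in>?C. if \<forall>(a, b)\<in>G. (real \<circ> c) a \<noteq> (real \<circ> c) b then 1 else 0)"
    unfolding sum_moebius_point[OF loopfree, symmetric]
    by (rule sum.cong[OF refl]) (simp only: sum.inter_filter[OF finite_flats])
  also have "\<dots> = int (card {c \<in> ?C. \<forall>(a, b)\<in>G. c a \<noteq> c b})"
    using fin by (simp add: sum.inter_filter[symmetric] case_prod_beta)
  finally show ?thesis .
qed

end

section \<open>The homogenized Linial arrangement as a graphical arrangement\<close>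

text \<open>
  With \<open>z i = x i - y i\<close> the hyperplane with indices \<open>i < j\<close> is \<open>z i = x j\<close>. Placing \<open>z i\<close> at the
  vertex \<open>2 * i - 1\<close> and \<open>x j\<close> at the vertex \<open>2 * j - 2\<close>, the edges join an odd vertex to all larger
  even ones; the coordinate \<open>x 1\<close> remains free.
\<close>

definition linial_coord :: "point \<Rightarrow> nat \<Rightarrow> real" where
  "linial_coord p v =
     (if odd v then fst p ((v + 1) div 2) - snd p ((v + 1) div 2) else fst p (v div 2 + 1))"

definition linial_graph :: "nat \<Rightarrow> (nat \<times> nat) set" where
  "linial_graph m = {(a, b). a \<in> {1..m} \<and> b \<in> {1..m} \<and> odd a \<and> even b \<and> a < b}"

lemma D_proper_iff: "D_proper m c \<longleftrightarrow> (\<forall>(a, b)\<in>linial_graph m. c a \<noteq> c b)"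
  unfolding D_proper_def linial_graph_def by blast

lemma linial_graph_loopfree: "\<forall>(a, b)\<in>linial_graph m. a \<noteq> b"
  by (auto simp: linial_graph_def)

lemma linial_graphical: "graphical_arrangement (ambient n) linial_coord {1..2*n} (linial_graph (2*n))"
proof
  show "linial_graph (2*n) \<subseteq> {1..2*n} \<times> {1..2*n}"
    by (auto simp: linial_graph_def)
  fix c :: "nat \<Rightarrow> real"
  \<comment> \<open>The value \<open>x 1\<close> is \<open>c 0\<close>, at an index outside the
    vertex set, so it is arbitrary; \<open>y\<close> then adjusts each \<open>x i - y i\<close> to
    the prescribed odd value.\<close>
  define x where "x = (\<lambda>j\<in>{1..n+1}. c (2 * j - 2))"
  define y where "y = (\<lambda>i\<in>{1..n}. x i - c (2 * i - 1))"
  have "linial_coord (x, y) v = c v" if v: "v \<in> {1..2*n}" for v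
  proof (cases "odd v")
    case True
    then obtain k where "v = 2 * k + 1" by (elim oddE)
    then show ?thesis
      using v by (simp add: linial_coord_def y_def)
  next
    case False
    then obtain k where "v = 2 * k" by (auto elim: evenE)
    then show ?thesis
      using v by (simp add: linial_coord_def x_def)
  qed
  moreover have "(x, y) \<in> ambient n"
    by (simp add: ambient_def x_def y_def)
  ultimately show "\<exists>p\<in>ambient n. \<forall>v\<in>{1..2*n}. linial_coord p v = c v"
    by blast
qed simp

global_interpretation linial: graphical_arrangement "ambient n" linial_coord "{1..2*n}" "linial_graph (2*n)"
  for n by (rule linial_graphical)

lemma linial_hyperplane_eq_hyp:
  assumes "1 \<le> i" "i < j"
  shows "linial_hyperplane n i j = linial.hyp n (2 * i - 1, 2 * j - 2)"
proof -
  have "odd (2 * i - 1)" "even (2 * j - 2)" "(2 * i - 1 + 1) div 2 = i" "(2 * j - 2) div 2 + 1 = j"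
    using assms by auto
  then show ?thesis
    unfolding linial_hyperplane_def linial.hyp_def linial_coord_def
    by (auto simp: algebra_simps)
qed

lemma homog_linial_eq_hyps: "homog_linial n = linial.hyp n ` linial_graph (2*n)"
proof (intro equalityI subsetI)
  fix H assume "H \<in> homog_linial n"
  then obtain i j where ij: "H = linial_hyperplane n i j" "1 \<le> i" "i < j" "j \<le> n + 1"
    by (auto simp: homog_linial_def)
  \<comment> \<open>The edge condition \<open>2 * i - 1 < 2 * j - 2\<close> holds exactly when
    \<open>i < j\<close>.\<close>
  then have "(2 * i - 1, 2 * j - 2) \<in> linial_graph (2*n)"
    by (auto simp: linial_graph_def)
  with ij show "H \<in> linial.hyp n ` linial_graph (2*n)"
    by (simp add: linial_hyperplane_eq_hyp)
next
  fix H assume "H \<in> linial.hyp n ` linial_graph (2*n)"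
  then obtain a b where ab: "H = linial.hyp n (a, b)" "a \<in> {1..2*n}" "b \<in> {1..2*n}" "odd a" "even b" "a < b"
    by (auto simp: linial_graph_def)
  obtain k l where kl: "a = 2 * k + 1" "b = 2 * l"
    using ab by (elim oddE evenE)
  then have "H = linial_hyperplane n (k + 1) (l + 1)"
    using ab by (simp add: linial_hyperplane_eq_hyp)
  moreover have "k + 1 < l + 1" "l + 1 \<le> n + 1"
    using ab kl by auto
  ultimately show "H \<in> homog_linial n"
    unfolding homog_linial_def by (metis (mono_tags, lifting) CollectI le_add2)
qed

text \<open>The graph is connected: odd vertices are adjacent to \<open>2*n\<close>, even ones to
  \<open>1\<close>, and these two to each other. Hence the centre has a single block.\<close>

lemma linial_nblocks_centre:
  assumes "n \<ge> 1"
  shows "linial.nblocks n (linial.centre n) = 1"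
proof -
  let ?b = "linial.block n (linial.centre n)"
  have edge: "?b a = ?b b" if "(a, b) \<in> linial_graph (2*n)" for a b
  proof -
    have "linial.centre n \<subseteq> linial.hyp n (a, b)"
      using that by (auto simp: linial.centre_def)
    moreover have "a \<in> {1..2*n}" "b \<in> {1..2*n}"
      using that by (auto simp: linial_graph_def)
    ultimately show ?thesis
      by (subst linial.block_eq_iff) (auto simp: linial.hyp_def)
  qed
  have "?b v = ?b (2*n)" if v: "v \<in> {1..2*n}" for v
  proof (cases "odd v")
    case True
    then have "(v, 2*n) \<in> linial_graph (2*n)"
      using v by (auto simp: linial_graph_def) (metis even_mult_iff even_numeral le_neq_implies_less)
    then show ?thesis by (rule edge)
  next
    case False
    then have "(1, v) \<in> linial_graph (2*n)" "(1, 2*n) \<in> linial_graph (2*n)"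
      using v assms by (auto simp: linial_graph_def elim!: evenE)
    from this[THEN edge] show ?thesis by simp
  qed
  moreover have "2*n \<in> {1..2*n}"
    using assms by simp
  ultimately have "?b ` {1..2*n} = {?b (2*n)}"
    by blast
  then show ?thesis
    by (simp only: linial.nblocks_def) simp
qed

section \<open>Comparison of the two polynomials\<close>

lemma poly_eqI_nat:
  fixes p q :: "int poly"
  assumes "\<And>t::nat. t \<ge> 1 \<Longrightarrow> poly p (int t) = poly q (int t)"
  shows "p = q"
proof (rule ccontr)
  assume "p \<noteq> q"
  then have "finite {x. poly (p - q) x = 0}"
    by (intro poly_roots_finite) simp
  moreover have "int ` {1..} \<subseteq> {x. poly (p - q) x = 0}"
    using assms by auto
  ultimately have "finite (int ` {1..})"
    by (rule rev_finite_subset)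
  then show False
    by (simp add: finite_image_iff infinite_Ici)
qed

theorem corollary4p11:
  fixes n :: nat
  assumes "n \<ge> 1"
  shows "char_poly_poset (linial_lattice n) = (\<Sum>k=1..2*n. monom (s_D (2*n) k) (k - 1))"
proof (rule poly_eqI_nat)
  fix t :: nat assume t: "t \<ge> 1"
  have "int t * poly (char_poly_poset (linial_lattice n)) (int t) =
      int (card {c \<in> {1..2*n} \<rightarrow>\<^sub>E {..<t}. D_proper (2*n) c})"
    using linial.char_poly_chromatic[OF linial_graph_loopfree, where t = t and n = n]
    unfolding linial_nblocks_centre[OF assms] D_proper_iff[symmetric]
    by (simp only: linial_lattice_def homog_linial_eq_hyps power_one_right)
  also have "\<dots> = (\<Sum>k=1..2*n. s_D (2*n) k * int t ^ k)"
    by (rule card_D_proper_s_D) fact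
  \<comment> \<open>As \<open>k\<close> starts at 1, a factor \<open>t\<close> splits off each
    term.\<close>
  also have "\<dots> = (\<Sum>k=1..2*n. int t * (s_D (2*n) k * int t ^ (k - 1)))"
    by (intro sum.cong) (auto simp: power_eq_if)
  also have "\<dots> = int t * poly (\<Sum>k=1..2*n. monom (s_D (2*n) k) (k - 1)) (int t)"
    by (simp add: poly_sum poly_monom sum_distrib_left)
  \<comment> \<open>Comparing values only at \<open>t \<ge> 1\<close> allows the factor
    \<open>t\<close> to be cancelled.\<close>
  finally show "poly (char_poly_poset (linial_lattice n)) (int t) =
      poly (\<Sum>k=1..2*n. monom (s_D (2*n) k) (k - 1)) (int t)"
    using t by simp
qed

end
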